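(* Let $\{x^k\}_{k\in\mathbb{N}_0}$ be the sequence of primal iterates generated by the difference-of-$\Phi$-convex algorithm ($\Phi$-DCA), and let $F=g-f$ satisfy the $\Phi$-DCA-PL inequality with constants $\mu_1,\mu_2$. Then $\{F(x^k)\}_{k\in\mathbb{N}_0}$ decreases $q$-linearly, and in particular $$F(x^{k+1})-\inf F\le\frac{1-\mu_1}{1+\mu_2}\big(F(x^k)-\inf F\big).$$
   Context: Setting. $X\subseteq\mathbb{R}^n$ and $Y\subseteq\mathbb{R}^m$ are nonempty and $\Phi:X\times Y\to\mathbb{R}$ is jointly continuous relative to $X\times Y$. $\overline{\mathbb{R}}=\mathbb{R}\cup\{\pm\infty\}$. A function is proper if it never takes the value $-\infty$ and is not identically $+\infty$. A function $f:X\to\overline{\mathbb{R}}$ is $\Phi$-convex if there are an index set $I$ and $(y_i,\beta_i)\in Y\times\overline{\mathbb{R}}$, $i\in I$, with $f(x)=\sup_{i\in I}\Phi(x,y_i)-\beta_i$ for all $x\in X$ (and $f\equiv-\infty$ if $I=\emptyset$). Standing assumptions: $f:X\to\overline{\mathbb{R}}$ is proper and $\Phi$-convex; $g:X\to\overline{\mathbb{R}}$ is proper and lower semicontinuous relative to $X$, and there exist $y\in Y$, $\beta\in\mathbb{R}$ with $g\ge\Phi(\cdot,y)-\beta$ on $X$; $F:=g-f$ (with the convention $g(x)-f(x)=+\infty$ if both values are $+\infty$) satisfies $-\infty<\inf_X F<\infty$. $\operatorname{dom}F=\{x\in X:F(x)<\infty\}$. $\Phi$-conjugate: for $\varphi:X\to\overline{\mathbb{R}}$,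 $\varphi^\Phi(y)=\sup_{x\in X}\Phi(x,y)-\varphi(x)$. $\Phi$-subdifferential: $y\in\partial_\Phi\varphi(\bar x)$ iff $y\in Y$ and $\varphi(x)\ge\varphi(\bar x)+\Phi(x,y)-\Phi(\bar x,y)$ for all $x\in X$. Inverse: $(\partial_\Phi g)^{-1}(y)=\{x\in X:y\in\partial_\Phi g(x)\}=\operatorname{argmin}_{x\in X}\{g(x)-\Phi(x,y)\}$. $\Phi$-DCA: starting from $x^0\in\operatorname{dom}\partial_\Phi f=\{x:\partial_\Phi f(x)\neq\emptyset\}$, for $k\in\mathbb{N}_0$ choose $y^k\in\partial_\Phi f(x^k)$ and $x^{k+1}\in(\partial_\Phi g)^{-1}(y^k)$. For well-definedness it is assumed that $\emptyset\ne\operatorname{rge}(\partial_\Phi g)^{-1}\subseteq\operatorname{dom}\partial_\Phi f$ and $\emptyset\neq\operatorname{rge}\partial_\Phi f\subseteq\operatorname{dom}(\partial_\Phi g)^{-1}$ (dom = set of points with nonempty image, rge = union of all images). Gap functions: $\operatorname{gap}_g^\Phi(x,y)=g(x)+g^\Phi(y)-\Phi(x,y)$ and $\operatorname{gap}_f^\Phi(y,x)=f(x)+f^\Phi(y)-\Phi(x,y)$. $\Phi$-DCA-PL inequality with constants $\mu_1,\mu_2$, where $\mu_1+\mu_2>0$: for $\bar x\in\operatorname{dom}F$, $\bar y\in\partial_\Phi f(\bar x)$ and $x^+\in\operatorname{argmin}_{x\in X}g(x)-\Phi(x,\bar y)$, $$\operatorname{gap}_g^\Phi(\bar x,\bar y)+\operatorname{gap}_f^\Phi(\bar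 y,x^+)\ge\mu_1(F(\bar x)-\inf F)+\mu_2(F(x^+)-\inf F).$$
   Formalization: The displayed inequality is not claimed for k = 0 when F(x^0) = +∞ and μ_1 ≥ 1: there its right-hand side can be an undefined product such as 0·∞, and the bound can fail; the q-linear decrease is still claimed for all k. *)

theory Defs
  imports "HOL-Analysis.Analysis"
begin

text \<open>
  Functions on \<open>X\<close> are total functions of which only the values on \<open>X\<close> are used.
  In \<^typ>\<open>ereal\<close>, \<open>\<infinity> - \<infinity> = \<infinity>\<close>, \<open>- \<infinity> + \<infinity> = \<infinity>\<close>, and the supremum of the empty set
  is \<open>- \<infinity>\<close>.
\<close>

definition proper_on :: "'a set \<Rightarrow> ('a \<Rightarrow> ereal) \<Rightarrow> bool" where
  "proper_on X h \<longleftrightarrow> (\<forall>x\<in>X. h x \<noteq> -\<infinity>) \<and> (\<exists>x\<in>X. h x \<noteq> \<infinity>)"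

definition lsc_on :: "'a::topological_space set \<Rightarrow> ('a \<Rightarrow> ereal) \<Rightarrow> bool" where
  "lsc_on X h \<longleftrightarrow> (\<forall>x\<in>X. h x \<le> Liminf (at x within X) h)"

definition edom :: "'a set \<Rightarrow> ('a \<Rightarrow> ereal) \<Rightarrow> 'a set" where
  "edom X h = {x\<in>X. h x < \<infinity>}"

text \<open>The family \<open>(y\<^sub>i, \<beta>\<^sub>i)\<close>, \<open>i \<in> I\<close>, is given by the set \<open>S\<close> of its members.\<close>

definition Phi_convex ::
  "'a set \<Rightarrow> 'b set \<Rightarrow> ('a \<Rightarrow> 'b \<Rightarrow> real) \<Rightarrow> ('a \<Rightarrow> ereal) \<Rightarrow> bool" where
  "Phi_convex X Y \<Phi> h \<longleftrightarrow>
     (\<exists>S :: ('b \<times> ereal) set. S \<subseteq> Y \<times> UNIV \<and>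
        (\<forall>x\<in>X. h x = (SUP (y, \<beta>)\<in>S. ereal (\<Phi> x y) - \<beta>)))"

definition Phi_conjugate ::
  "'a set \<Rightarrow> ('a \<Rightarrow> 'b \<Rightarrow> real) \<Rightarrow> ('a \<Rightarrow> ereal) \<Rightarrow> 'b \<Rightarrow> ereal" where
  "Phi_conjugate X \<Phi> h y = (SUP x\<in>X. ereal (\<Phi> x y) - h x)"

definition Phi_subdiff ::
  "'a set \<Rightarrow> 'b set \<Rightarrow> ('a \<Rightarrow> 'b \<Rightarrow> real) \<Rightarrow> ('a \<Rightarrow> ereal) \<Rightarrow> 'a \<Rightarrow> 'b set" where
  "Phi_subdiff X Y \<Phi> h xbar =
     {y\<in>Y. \<forall>x\<in>X. h x \<ge> h xbar + ereal (\<Phi> x y) - ereal (\<Phi> xbar y)}"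

definition Phi_subdiff_inv ::
  "'a set \<Rightarrow> 'b set \<Rightarrow> ('a \<Rightarrow> 'b \<Rightarrow> real) \<Rightarrow> ('a \<Rightarrow> ereal) \<Rightarrow> 'b \<Rightarrow> 'a set" where
  "Phi_subdiff_inv X Y \<Phi> h y = {x\<in>X. y \<in> Phi_subdiff X Y \<Phi> h x}"

text \<open>Domain and range of a set-valued map defined on \<open>A\<close>.\<close>

definition mdom :: "'a set \<Rightarrow> ('a \<Rightarrow> 'b set) \<Rightarrow> 'a set" where
  "mdom A M = {a\<in>A. M a \<noteq> {}}"

definition mrge :: "'a set \<Rightarrow> ('a \<Rightarrow> 'b set) \<Rightarrow> 'b set" where
  "mrge A M = (\<Union>a\<in>A. M a)"

definition DCA_well_defined ::
  "'a set \<Rightarrow> 'b set \<Rightarrow> ('a \<Rightarrow> 'b \<Rightarrow> real) \<Rightarrow> ('a \<Rightarrow> ereal) \<Rightarrow> ('a \<Rightarrow> ereal) \<Rightarrow> bool" where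
  "DCA_well_defined X Y \<Phi> g f \<longleftrightarrow>
     mrge Y (Phi_subdiff_inv X Y \<Phi> g) \<noteq> {} \<and>
     mrge Y (Phi_subdiff_inv X Y \<Phi> g) \<subseteq> mdom X (Phi_subdiff X Y \<Phi> f) \<and>
     mrge X (Phi_subdiff X Y \<Phi> f) \<noteq> {} \<and>
     mrge X (Phi_subdiff X Y \<Phi> f) \<subseteq> mdom Y (Phi_subdiff_inv X Y \<Phi> g)"

text \<open>
  The starting point may lie outside the domain of \<open>g\<close>, so that \<open>g - f\<close> is \<open>\<infinity>\<close> at \<open>x 0\<close>; under
  \<open>DCA_well_defined\<close> it is finite at all later iterates when \<open>f\<close> and \<open>g\<close> are proper.
\<close>

definition DCA_iterates ::
  "'a set \<Rightarrow> 'b set \<Rightarrow> ('a \<Rightarrow> 'b \<Rightarrow> real) \<Rightarrow> ('a \<Rightarrow> ereal) \<Rightarrow> ('a \<Rightarrow> ereal)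
    \<Rightarrow> (nat \<Rightarrow> 'a) \<Rightarrow> (nat \<Rightarrow> 'b) \<Rightarrow> bool" where
  "DCA_iterates X Y \<Phi> g f x y \<longleftrightarrow>
     x 0 \<in> mdom X (Phi_subdiff X Y \<Phi> f) \<and>
     (\<forall>k. y k \<in> Phi_subdiff X Y \<Phi> f (x k) \<and> x (Suc k) \<in> Phi_subdiff_inv X Y \<Phi> g (y k))"

text \<open>
  \<open>Phi_gap X \<Phi> g x y\<close> and \<open>Phi_gap X \<Phi> f x y\<close> are \<open>gap\<^sub>g(x, y)\<close> and \<open>gap\<^sub>f(y, x)\<close>; the point of \<open>X\<close>
  always comes first here.
\<close>

definition Phi_gap ::
  "'a set \<Rightarrow> ('a \<Rightarrow> 'b \<Rightarrow> real) \<Rightarrow> ('a \<Rightarrow> ereal) \<Rightarrow> 'a \<Rightarrow> 'b \<Rightarrow> ereal" where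
  "Phi_gap X \<Phi> h x y = h x + Phi_conjugate X \<Phi> h y - ereal (\<Phi> x y)"

definition DC_fun :: "('a \<Rightarrow> ereal) \<Rightarrow> ('a \<Rightarrow> ereal) \<Rightarrow> 'a \<Rightarrow> ereal" where
  "DC_fun g f x = g x - f x"

definition DC_inf :: "'a set \<Rightarrow> ('a \<Rightarrow> ereal) \<Rightarrow> ('a \<Rightarrow> ereal) \<Rightarrow> ereal" where
  "DC_inf X g f = (INF x\<in>X. DC_fun g f x)"

definition DCA_PL ::
  "'a set \<Rightarrow> 'b set \<Rightarrow> ('a \<Rightarrow> 'b \<Rightarrow> real) \<Rightarrow> ('a \<Rightarrow> ereal) \<Rightarrow> ('a \<Rightarrow> ereal)
    \<Rightarrow> real \<Rightarrow> real \<Rightarrow> bool" where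
  "DCA_PL X Y \<Phi> g f \<mu>1 \<mu>2 \<longleftrightarrow>
     \<mu>1 + \<mu>2 > 0 \<and>
     (\<forall>xbar \<in> edom X (DC_fun g f). \<forall>ybar \<in> Phi_subdiff X Y \<Phi> f xbar. \<forall>xp.
        is_arg_min (\<lambda>x. g x - ereal (\<Phi> x ybar)) (\<lambda>x. x \<in> X) xp \<longrightarrow>
        Phi_gap X \<Phi> g xbar ybar + Phi_gap X \<Phi> f xp ybar
          \<ge> ereal \<mu>1 * (DC_fun g f xbar - DC_inf X g f)
            + ereal \<mu>2 * (DC_fun g f xp - DC_inf X g f))"

text \<open>The values \<open>a k\<close> decrease q-linearly to the level \<open>l\<close>.\<close>

definition q_linearly_decreasing :: "(nat \<Rightarrow> ereal) \<Rightarrow> ereal \<Rightarrow> bool" where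
  "q_linearly_decreasing a l \<longleftrightarrow>
     decseq a \<and> (\<exists>q::real. 0 < q \<and> q < 1 \<and> (\<forall>k. a (Suc k) - l \<le> ereal q * (a k - l)))"

end

theory Submission
  imports Defs
begin

text \<open>
  Let \<open>v\<close> be a subgradient of \<open>f\<close> at \<open>u\<close>, and let \<open>v\<close> be a subgradient of \<open>g\<close> at \<open>w\<close>; the pair
  \<open>u\<close>, \<open>w\<close> is then one step of the algorithm. The Fenchel--Young inequality is an equality at both
  pairs, which gives \<open>f\<^sup>\<Phi>(v) = \<Phi>(u, v) - f(u)\<close> and \<open>g\<^sup>\<Phi>(v) = \<Phi>(w, v) - g(w)\<close>. When these values
  are inserted in \<open>gap\<^sub>g(u, v) + gap\<^sub>f(v, w)\<close>, all values of \<open>\<Phi>\<close> cancel and the sum telescopes to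
  \<open>F(u) - F(w)\<close> (\<open>Phi_gap_sum_eq_decrease\<close>). The PL inequality is therefore a lower bound for the
  decrease of \<open>F\<close> in one step: with \<open>a = F(u) - inf F\<close> and \<open>b = F(w) - inf F\<close> it reads
  \<open>a - b \<ge> \<mu>\<^sub>1 a + \<mu>\<^sub>2 b\<close>, that is \<open>(1 + \<mu>\<^sub>2) b \<le> (1 - \<mu>\<^sub>1) a\<close>.

  Two points need care. The sign of \<open>1 + \<mu>\<^sub>2\<close> is not prescribed; if it is not positive, then
  \<open>\<mu>\<^sub>1 + \<mu>\<^sub>2 > 0\<close> and \<open>0 \<le> b \<le> a\<close> force \<open>a = b = 0\<close>. Moreover \<open>F\<close> may be \<open>\<infinity>\<close> at the starting point,
  where the PL inequality says nothing; at this step the bound is trivial, since its right-hand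
  side is \<open>\<infinity>\<close> as soon as the contraction factor is positive. For \<open>(1 - \<mu>\<^sub>1) / (1 + \<mu>\<^sub>2)\<close> this holds
  if \<open>\<mu>\<^sub>1 < 1\<close>; for q-linear decrease the rate can always be chosen positive
  (\<open>PL_decrease_rate\<close>).
\<close>

lemma Phi_subdiffD:
  assumes "v \<in> Phi_subdiff X Y \<Phi> h u" "w \<in> X"
  shows "h u + ereal (\<Phi> w v) - ereal (\<Phi> u v) \<le> h w"
  using assms by (auto simp: Phi_subdiff_def)

text \<open>
  The subgradient inequality at a point where a proper function is finite bounds its value at
  \<open>u\<close> from above.
\<close>

lemma finite_at_Phi_subgradient:
  assumes h: "proper_on X h" and u: "u \<in> X" and v: "v \<in> Phi_subdiff X Y \<Phi> h u"
  shows "\<bar>h u\<bar> \<noteq> \<infinity>"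
proof -
  obtain w where w: "w \<in> X" "h w \<noteq> \<infinity>"
    using h by (auto simp: proper_on_def)
  have "h u \<noteq> \<infinity>"
    using Phi_subdiffD[OF v w(1)] w(2) by auto
  moreover have "h u \<noteq> -\<infinity>"
    using h u by (auto simp: proper_on_def)
  ultimately show ?thesis by auto
qed

text \<open>
  Equality in the Fenchel--Young inequality: the subgradient inequality says that the supremum
  defining the conjugate is attained at \<open>u\<close>.
\<close>

lemma Phi_conjugate_at_subgradient:
  assumes h: "proper_on X h" and u: "u \<in> X" and v: "v \<in> Phi_subdiff X Y \<Phi> h u"
  shows "Phi_conjugate X \<Phi> h v = ereal (\<Phi> u v) - h u"
  unfolding Phi_conjugate_def
proof (rule antisym)
  show "ereal (\<Phi> u v) - h u \<le> (SUP w\<in>X. ereal (\<Phi> w v) - h w)"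
    using u by (rule SUP_upper)
  show "(SUP w\<in>X. ereal (\<Phi> w v) - h w) \<le> ereal (\<Phi> u v) - h u"
  proof (rule SUP_least)
    fix w assume "w \<in> X"
    with Phi_subdiffD[OF v this] finite_at_Phi_subgradient[OF h u v]
    show "ereal (\<Phi> w v) - h w \<le> ereal (\<Phi> u v) - h u"
      by (cases "h w"; cases "h u") auto
  qed
qed

lemma is_arg_min_of_Phi_subgradient:
  assumes h: "proper_on X h" and u: "u \<in> X" and v: "v \<in> Phi_subdiff X Y \<Phi> h u"
  shows "is_arg_min (\<lambda>w. h w - ereal (\<Phi> w v)) (\<lambda>w. w \<in> X) u"
proof -
  have "h u - ereal (\<Phi> u v) \<le> h w - ereal (\<Phi> w v)" if "w \<in> X" for w
    using Phi_subdiffD[OF v that] finite_at_Phi_subgradient[OF h u v]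
    by (cases "h w"; cases "h u") auto
  then show ?thesis
    using u by (auto simp: is_arg_min_def not_less)
qed

text \<open>
  The subgradient inequality of \<open>f\<close> is taken at \<open>w\<close> and that of \<open>g\<close> at \<open>u\<close>, so that the values
  of \<open>\<Phi>\<close> cancel when the two are added.
\<close>

lemma DC_fun_step_le:
  assumes f: "proper_on X f" and g: "proper_on X g" and u: "u \<in> X" and w: "w \<in> X"
    and vf: "v \<in> Phi_subdiff X Y \<Phi> f u" and vg: "v \<in> Phi_subdiff X Y \<Phi> g w"
  shows "DC_fun g f w \<le> DC_fun g f u"
  using Phi_subdiffD[OF vf w] Phi_subdiffD[OF vg u]
    finite_at_Phi_subgradient[OF f u vf] finite_at_Phi_subgradient[OF g w vg]
  unfolding DC_fun_def
  by (cases "f u"; cases "g w"; cases "f w"; cases "g u") auto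

lemma Phi_gap_sum_eq_decrease:
  assumes f: "proper_on X f" and g: "proper_on X g" and u: "u \<in> X" and w: "w \<in> X"
    and vf: "v \<in> Phi_subdiff X Y \<Phi> f u" and vg: "v \<in> Phi_subdiff X Y \<Phi> g w"
    and fin: "\<bar>f w\<bar> \<noteq> \<infinity>"
  shows "Phi_gap X \<Phi> g u v + Phi_gap X \<Phi> f w v = DC_fun g f u - DC_fun g f w"
proof -
  have "g u \<noteq> -\<infinity>"
    using g u by (auto simp: proper_on_def)
  then show ?thesis
    using finite_at_Phi_subgradient[OF f u vf] finite_at_Phi_subgradient[OF g w vg] fin
    unfolding Phi_gap_def DC_fun_def
      Phi_conjugate_at_subgradient[OF f u vf] Phi_conjugate_at_subgradient[OF g w vg]
    by (cases "f u"; cases "g w"; cases "f w"; cases "g u") auto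
qed

lemma PL_decrease_degenerate:
  fixes a b \<mu>1 \<mu>2 :: real
  assumes "0 \<le> b" "b \<le> a" "\<mu>1 + \<mu>2 > 0" "\<mu>1 * a + \<mu>2 * b \<le> a - b" "1 + \<mu>2 \<le> 0"
  shows "a = 0" and "b = 0"
proof -
  have "(1 + \<mu>2) * a \<le> (1 + \<mu>2) * b"
    using assms by (intro mult_left_mono_neg) auto
  then have "(\<mu>1 + \<mu>2) * a \<le> 0"
    using assms(4) by (simp add: algebra_simps)
  then show "a = 0"
    using assms by (simp add: mult_le_0_iff)
  then show "b = 0" using assms by simp
qed

lemma PL_decrease_contracts:
  fixes a b \<mu>1 \<mu>2 :: real
  assumes "0 \<le> b" "b \<le> a" "\<mu>1 + \<mu>2 > 0" "\<mu>1 * a + \<mu>2 * b \<le> a - b"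
  shows "b \<le> (1 - \<mu>1) / (1 + \<mu>2) * a"
proof (cases "1 + \<mu>2 > 0")
  case True
  then show ?thesis using assms(4) by (simp add: field_simps)
next
  case False
  then show ?thesis using PL_decrease_degenerate[OF assms] by simp
qed

text \<open>
  The factor \<open>(1 - \<mu>1) / (1 + \<mu>2)\<close> itself may fail to lie strictly between 0 and 1: it is at most 0
  if \<open>\<mu>1 \<ge> 1\<close> and \<open>1 + \<mu>2 \<ge> 0\<close>, and it exceeds 1 if \<open>1 + \<mu>2 < 0\<close>. In these cases \<open>b = 0\<close>, so that
  1/2 serves as a rate.
\<close>

lemma PL_decrease_rate:
  fixes \<mu>1 \<mu>2 :: real
  assumes \<mu>: "\<mu>1 + \<mu>2 > 0"
  obtains q :: real where "0 < q" "q < 1"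
    "\<And>a b. 0 \<le> b \<Longrightarrow> b \<le> a \<Longrightarrow> \<mu>1 * a + \<mu>2 * b \<le> a - b \<Longrightarrow> b \<le> q * a"
proof (cases "1 + \<mu>2 > 0")
  case True
  define c where "c = (1 - \<mu>1) / (1 + \<mu>2)"
  have c: "c < 1"
    using True \<mu> by (simp add: c_def field_simps)
  show thesis
  proof (rule that[of "max (1/2) c"])
    fix a b :: real
    assume ab: "0 \<le> b" "b \<le> a" "\<mu>1 * a + \<mu>2 * b \<le> a - b"
    have "b \<le> c * a"
      using PL_decrease_contracts[OF ab(1,2) \<mu> ab(3)] by (simp add: c_def)
    also have "\<dots> \<le> max (1/2) c * a"
      using ab by (intro mult_right_mono) auto
    finally show "b \<le> max (1/2) c * a" .
  qed (use c in auto)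
next
  case False
  show thesis
  proof (rule that[of "1/2"])
    fix a b :: real
    assume ab: "0 \<le> b" "b \<le> a" "\<mu>1 * a + \<mu>2 * b \<le> a - b"
    show "b \<le> 1/2 * a"
      using PL_decrease_degenerate[OF ab(1,2) \<mu> ab(3)] False by simp
  qed auto
qed

theorem theorem6p2:
  fixes X :: "(real ^ 'n) set" and Y :: "(real ^ 'm) set"
    and \<Phi> :: "real ^ 'n \<Rightarrow> real ^ 'm \<Rightarrow> real"
    and f g :: "real ^ 'n \<Rightarrow> ereal"
    and x :: "nat \<Rightarrow> real ^ 'n" and y :: "nat \<Rightarrow> real ^ 'm"
    and \<mu>1 \<mu>2 :: real
  assumes "X \<noteq> {}" and "Y \<noteq> {}"
    and "continuous_on (X \<times> Y) (\<lambda>(u, v). \<Phi> u v)"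
    and "proper_on X f" and "Phi_convex X Y \<Phi> f"
    and "proper_on X g" and "lsc_on X g"
    and "\<exists>v\<in>Y. \<exists>\<beta>::real. \<forall>u\<in>X. g u \<ge> ereal (\<Phi> u v - \<beta>)"
    and "- \<infinity> < DC_inf X g f" and "DC_inf X g f < \<infinity>"
    and "DCA_well_defined X Y \<Phi> g f"
    and "DCA_iterates X Y \<Phi> g f x y"
    and "DCA_PL X Y \<Phi> g f \<mu>1 \<mu>2"
  shows "q_linearly_decreasing (\<lambda>k. DC_fun g f (x k)) (DC_inf X g f) \<and>
    (\<forall>k. \<not> (k = 0 \<and> DC_fun g f (x 0) = \<infinity> \<and> \<mu>1 \<ge> 1) \<longrightarrow>
       DC_fun g f (x (Suc k)) - DC_inf X g f
         \<le> ereal ((1 - \<mu>1) / (1 + \<mu>2)) * (DC_fun g f (x k) - DC_inf X g f))"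
proof -
  note f = assms(4) and g = assms(6)
  define F where "F = DC_fun g f"
  obtain m where m: "DC_inf X g f = ereal m"
    using assms(9,10) by (cases "DC_inf X g f") auto
  have \<mu>: "\<mu>1 + \<mu>2 > 0"
    using assms(13) by (simp add: DCA_PL_def)
  have yf: "y k \<in> Phi_subdiff X Y \<Phi> f (x k)"
    and yg: "y k \<in> Phi_subdiff X Y \<Phi> g (x (Suc k))" and xS: "x (Suc k) \<in> X" for k
    using assms(12) by (auto simp: DCA_iterates_def Phi_subdiff_inv_def)
  have xX: "x k \<in> X" for k
    using assms(12) xS by (cases k) (auto simp: DCA_iterates_def mdom_def)
  have fin: "\<bar>f (x k)\<bar> \<noteq> \<infinity>" and ginf: "\<bar>g (x (Suc k))\<bar> \<noteq> \<infinity>" for k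
    using finite_at_Phi_subgradient[OF f xX yf] finite_at_Phi_subgradient[OF g xS yg] by auto
  have FS: "\<bar>F (x (Suc k))\<bar> \<noteq> \<infinity>" for k
    using fin[of "Suc k"] ginf[of k] unfolding F_def DC_fun_def
    by (cases "f (x (Suc k))"; cases "g (x (Suc k))") auto
  have desc: "F (x (Suc k)) \<le> F (x k)" for k
    unfolding F_def by (rule DC_fun_step_le[OF f g xX xS yf yg])
  have lower: "ereal m \<le> F (x k)" for k
    unfolding m[symmetric] DC_inf_def F_def using xX by (rule INF_lower)
  have F_infinite: "k = 0" if "F (x k) = \<infinity>" for k
    using that FS[of "k - 1"] by (cases k) auto
  have step: "\<exists>a b. F (x k) - ereal m = ereal a \<and> F (x (Suc k)) - ereal m = ereal b
      \<and> 0 \<le> b \<and> b \<le> a \<and> \<mu>1 * a + \<mu>2 * b \<le> a - b" if nt: "F (x k) \<noteq> \<infinity>" for k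
  proof -
    obtain a' where a': "F (x k) = ereal a'"
      using nt lower[of k] by (cases "F (x k)") auto
    obtain b' where b': "F (x (Suc k)) = ereal b'"
      using FS[of k] by (cases "F (x (Suc k))") auto
    have "x k \<in> edom X (DC_fun g f)"
      using xX nt by (simp add: edom_def F_def less_top)
    then have "ereal \<mu>1 * (F (x k) - ereal m) + ereal \<mu>2 * (F (x (Suc k)) - ereal m)
        \<le> Phi_gap X \<Phi> g (x k) (y k) + Phi_gap X \<Phi> f (x (Suc k)) (y k)"
      using assms(13) yf is_arg_min_of_Phi_subgradient[OF g xS yg]
      unfolding DCA_PL_def F_def m by blast
    also have "\<dots> = F (x k) - F (x (Suc k))"
      unfolding F_def by (rule Phi_gap_sum_eq_decrease[OF f g xX xS yf yg fin])
    finally have "\<mu>1 * (a' - m) + \<mu>2 * (b' - m) \<le> (a' - m) - (b' - m)"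
      by (simp add: a' b')
    then show ?thesis
      using desc[of k] lower[of "Suc k"] unfolding a' b' by auto
  qed
  obtain q where q: "0 < q" "q < 1"
    "\<And>a b. 0 \<le> b \<Longrightarrow> b \<le> a \<Longrightarrow> \<mu>1 * a + \<mu>2 * b \<le> a - b \<Longrightarrow> b \<le> q * a"
    using PL_decrease_rate[OF \<mu>] by blast
  have rate: "F (x (Suc k)) - ereal m \<le> ereal q * (F (x k) - ereal m)" for k
  proof (cases "F (x k) = \<infinity>")
    case True
    then show ?thesis using q(1) by simp
  next
    case False
    from step[OF False] q(3) show ?thesis by auto
  qed
  have "q_linearly_decreasing (\<lambda>k. F (x k)) (ereal m)"
    unfolding q_linearly_decreasing_def using desc rate q(1,2) by (auto intro: decseq_SucI)
  moreover have "F (x (Suc k)) - ereal m \<le> ereal ((1 - \<mu>1) / (1 + \<mu>2)) * (F (x k) - ereal m)"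
    if "\<not> (k = 0 \<and> F (x 0) = \<infinity> \<and> \<mu>1 \<ge> 1)" for k
  proof (cases "F (x k) = \<infinity>")
    case True
    then have "\<mu>1 < 1" using that F_infinite[OF True] by auto
    with \<mu> have "1 - \<mu>1 > 0" "1 + \<mu>2 > 0" by auto
    then show ?thesis using True by simp
  next
    case False
    from step[OF False] PL_decrease_contracts[OF _ _ \<mu>] show ?thesis by fastforce
  qed
  ultimately show ?thesis
    unfolding F_def m by blast
qed

end
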